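(* There exists a universal constant $c > 0$ such that for every integer $n \geq 1$ and every collection of $n$ great circles on $\mathbb{S}^2$ such that any two of them intersect at an angle $\geq 1/(100\sqrt{n})$, the $1/n$-neighborhoods $C_1, \dots, C_n$ of these great circles satisfy $$ \left| \bigcup_{i=1}^{n} C_i \right| \geq c. $$
   Context: $\mathbb{S}^2$ is the unit sphere in $\mathbb{R}^3$. A great circle is the intersection of $\mathbb{S}^2$ with a plane through the origin. The angle of intersection of two great circles is the angle in $[0,\pi/2]$ between the corresponding planes. The $1/n$-neighborhood of a great circle is the set of points of $\mathbb{S}^2$ at geodesic distance at most $1/n$ from it. $|\cdot|$ denotes surface area on $\mathbb{S}^2$ (total area $4\pi$). *)

theory Defs
  imports "HOL-Analysis.Analysis"
begin

abbreviation S2 :: "(real^3) set"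
  where "S2 \<equiv> sphere 0 1"

definition plane_through_origin :: "(real^3) set \<Rightarrow> bool"
  where "plane_through_origin P \<longleftrightarrow> subspace P \<and> dim P = 2"

definition great_circle :: "(real^3) set \<Rightarrow> bool"
  where "great_circle G \<longleftrightarrow> (\<exists>P. plane_through_origin P \<and> G = S2 \<inter> P)"

definition unit_normal :: "(real^3) set \<Rightarrow> real^3 \<Rightarrow> bool"
  where "unit_normal P u \<longleftrightarrow> norm u = 1 \<and> (\<forall>x\<in>P. orthogonal u x)"

text \<open>The angle in [0, pi/2] between two planes is the acute angle between their normal lines.
  The absolute value makes it independent of the orientation of the normals, so the definite
  description is well defined: see plane_angle_eq below.\<close>

definition plane_angle :: "(real^3) set \<Rightarrow> (real^3) set \<Rightarrow> real"
  where "plane_angle P Q =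
    (THE a. \<exists>u v. unit_normal P u \<and> unit_normal Q v \<and> a = arccos \<bar>u \<bullet> v\<bar>)"

text \<open>The plane of a great circle is its linear span: see span_great_circle below.\<close>

definition intersection_angle :: "(real^3) set \<Rightarrow> (real^3) set \<Rightarrow> real"
  where "intersection_angle G H = plane_angle (span G) (span H)"

text \<open>Geodesic distance of two points of the unit sphere (length of the shorter great circle
  arc joining them); only meaningful for points of the sphere.\<close>

definition geodesic_dist :: "real^3 \<Rightarrow> real^3 \<Rightarrow> real"
  where "geodesic_dist x y = arccos (x \<bullet> y)"

definition geodesic_nbhd :: "real \<Rightarrow> (real^3) set \<Rightarrow> (real^3) set"
  where "geodesic_nbhd r G = {x \<in> S2. (INF y\<in>G. geodesic_dist x y) \<le> r}"

text \<open>Surface area of a subset of the unit sphere as cone measure: the solid cone over the set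
  with apex at the centre has volume (1/3) * radius * area. This is the rotation invariant
  measure of total mass 4 * pi, see the last two lemmas.\<close>

definition solid_cone :: "(real^3) set \<Rightarrow> (real^3) set"
  where "solid_cone A = {t *\<^sub>R x | t x. 0 \<le> t \<and> t \<le> 1 \<and> x \<in> A}"

definition surface_area :: "(real^3) set \<Rightarrow> real"
  where "surface_area A = 3 * measure lebesgue (solid_cone A)"

lemma span_great_circle:
  assumes "plane_through_origin P"
  shows "span (S2 \<inter> P) = P"
proof
  have P: "subspace P" using assms by (simp add: plane_through_origin_def)
  show "span (S2 \<inter> P) \<subseteq> P"
    by (simp add: P span_minimal)
  show "P \<subseteq> span (S2 \<inter> P)"
  proof
    fix x assume x: "x \<in> P"
    show "x \<in> span (S2 \<inter> P)"
    proof (cases "x = 0")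
      case True
      then show ?thesis by (simp add: span_zero)
    next
      case False
      have "inverse (norm x) *\<^sub>R x \<in> S2 \<inter> P"
        using False x P by (simp add: subspace_scale)
      then have "norm x *\<^sub>R (inverse (norm x) *\<^sub>R x) \<in> span (S2 \<inter> P)"
        by (intro span_scale span_base)
      then show ?thesis using False by simp
    qed
  qed
qed

lemma unit_normal_exists:
  assumes "plane_through_origin P"
  shows "\<exists>u. unit_normal P u"
proof -
  have "dim P < DIM(real^3)" using assms by (simp add: plane_through_origin_def)
  then obtain a where a: "a \<noteq> 0" "\<And>y. y \<in> span P \<Longrightarrow> orthogonal a y"
    using orthogonal_to_subspace_exists by blast
  then have "unit_normal P (a /\<^sub>R norm a)"
    by (auto simp: unit_normal_def span_base orthogonal_clauses)
  then show ?thesis ..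
qed

lemma unit_normal_unique:
  assumes "plane_through_origin P" "unit_normal P u" "unit_normal P v"
  shows "v = u \<or> v = - u"
proof -
  define N where "N = {y. \<forall>x\<in>P. orthogonal x y}"
  have P: "subspace P" "dim P = 2" using assms(1) by (auto simp: plane_through_origin_def)
  have N: "subspace N" unfolding N_def by (rule subspace_orthogonal_to_vectors)
  have "dim {y \<in> UNIV. \<forall>x\<in>P. orthogonal x y} + dim P = dim (UNIV :: (real^3) set)"
    by (rule dim_subspace_orthogonal_to_vectors) (auto simp: P)
  then have dN: "dim N = 1" using P by (simp add: N_def)
  have uv: "u \<in> N" "v \<in> N" "norm u = 1" "norm v = 1"
    using assms by (auto simp: N_def unit_normal_def orthogonal_commute)
  have u0: "u \<noteq> 0" using uv by auto
  have "span {u} = span N"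
    by (rule dim_eq_span) (use uv u0 dN in \<open>auto simp: dim_singleton\<close>)
  then have "v \<in> span {u}" using uv span_base by blast
  then obtain k where k: "v = k *\<^sub>R u" by (auto simp: span_singleton)
  then have "\<bar>k\<bar> = 1" using uv by simp
  then have "k = 1 \<or> k = -1" by linarith
  then show ?thesis using k by auto
qed

lemma plane_angle_eq:
  assumes "plane_through_origin P" "plane_through_origin Q" "unit_normal P u" "unit_normal Q v"
  shows "plane_angle P Q = arccos \<bar>u \<bullet> v\<bar>"
  unfolding plane_angle_def
proof (rule the_equality)
  show "\<exists>u' v'. unit_normal P u' \<and> unit_normal Q v' \<and> arccos \<bar>u \<bullet> v\<bar> = arccos \<bar>u' \<bullet> v'\<bar>"
    using assms by blast
next
  fix a assume "\<exists>u' v'. unit_normal P u' \<and> unit_normal Q v' \<and> a = arccos \<bar>u' \<bullet> v'\<bar>"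
  then obtain u' v' where "unit_normal P u'" "unit_normal Q v'" "a = arccos \<bar>u' \<bullet> v'\<bar>"
    by blast
  moreover from this have "u' = u \<or> u' = - u" "v' = v \<or> v' = - v"
    using unit_normal_unique assms by blast+
  ultimately show "a = arccos \<bar>u \<bullet> v\<bar>"
    by auto
qed

lemma surface_area_sphere: "surface_area S2 = 4 * pi"
proof -
  have "solid_cone S2 = cball 0 1"
  proof
    show "solid_cone S2 \<subseteq> cball 0 1" by (auto simp: solid_cone_def)
    show "cball 0 1 \<subseteq> solid_cone S2"
    proof
      fix x :: "real^3" assume x: "x \<in> cball 0 1"
      obtain e :: "real^3" where e: "norm e = 1" using vector_choose_size[of 1] by auto
      show "x \<in> solid_cone S2"
      proof (cases "x = 0")
        case True
        then show ?thesis using e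
          by (auto simp: solid_cone_def intro!: exI[of _ 0] exI[of _ e])
      next
        case False
        then show ?thesis using x
          by (auto simp: solid_cone_def intro!: exI[of _ "norm x"] exI[of _ "x /\<^sub>R norm x"])
      qed
    qed
  qed
  moreover have "measure lebesgue (cball (0 :: real^3) 1) = 4 / 3 * pi"
    by (simp add: content_cball unit_ball_vol_3)
  ultimately show ?thesis by (simp add: surface_area_def)
qed

lemma surface_area_orthogonal_image:
  assumes f: "orthogonal_transformation f" and A: "solid_cone A \<in> lmeasurable"
  shows "surface_area (f ` A) = surface_area A"
proof -
  have lin: "linear f" using f by (rule orthogonal_transformation_linear)
  have "solid_cone (f ` A) = f ` solid_cone A"
  proof
    show "solid_cone (f ` A) \<subseteq> f ` solid_cone A"
      unfolding solid_cone_def by (force simp flip: linear_scale[OF lin])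
    show "f ` solid_cone A \<subseteq> solid_cone (f ` A)"
      unfolding solid_cone_def by (force simp: linear_scale[OF lin])
  qed
  then show ?thesis
    by (simp add: surface_area_def measure_orthogonal_image[OF f A])
qed

end

(*
  Second moment method. A band of width 1/n has area about 1/n, and two bands meeting at angle
  \<theta> overlap in area O(1 / (n^2 sin \<theta>)). The normals are n^(-1/2)-separated in the projective
  plane, so only O(n \<rho>^2) of them lie within angle \<rho> of a given one; hence the overlaps of a
  fixed band with all the others sum to O(1/n), the integral of the squared counting function is
  bounded, and the union cannot be small. Areas are compared through solid cones truncated to
  1/2 \<le> |x| \<le> 1, where all volume estimates reduce to those of boxes in adapted orthonormal
  frames.
*)
theory Submission
  imports Defs
begin

section \<open>Volumes of bands\<close>

text \<open>The matrix with rows \<open>u\<close>, \<open>w\<close> and \<open>cross3 u w\<close> is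
  orthogonal, and its first two coordinates are the inner products that define two slabs. Slab
  conditions thus become coordinate bounds, and volumes are preserved.\<close>

lemma orthonormal_frame:
  fixes u w :: "real^3"
  assumes "norm u = 1" "norm w = 1" "u \<bullet> w = 0"
  obtains f :: "real^3 \<Rightarrow> real^3" where "orthogonal_transformation f"
    "\<And>x. f x $ 1 = u \<bullet> x" "\<And>x. f x $ 2 = w \<bullet> x"
proof -
  define z where "z = cross3 u w"
  define A :: "real^3^3" where "A = vector [u, w, z]"
  have "(norm z)\<^sup>2 = 1" using assms by (simp add: z_def norm_cross)
  then have nz: "norm z = 1" by (simp add: power2_eq_1_iff) (smt (verit) norm_ge_zero)
  have rows: "row 1 A = u" "row 2 A = w" "row 3 A = z"
    by (simp_all add: A_def row_def vector_def vec_eq_iff)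
  have "orthogonal_matrix A"
    unfolding orthogonal_matrix_orthonormal_rows forall_3 rows
    using assms nz by (simp add: orthogonal_def z_def dot_cross_self inner_commute)
  then have "orthogonal_transformation ((*v) A)"
    by (simp add: orthogonal_transformation_matrix)
  moreover have "(A *v x) $ 1 = u \<bullet> x" "(A *v x) $ 2 = w \<bullet> x" for x
    by (simp_all add: A_def matrix_vector_mult_def inner_vec_def)
  ultimately show thesis by (rule that)
qed

lemma orthonormal_frame_exists:
  fixes u :: "real^3"
  assumes "norm u = 1"
  obtains f :: "real^3 \<Rightarrow> real^3" where "orthogonal_transformation f" "\<And>x. f x $ 1 = u \<bullet> x"
proof -
  obtain y where y: "y \<noteq> 0" "orthogonal u y"
    using orthogonal_to_vector_exists[of u] by auto
  then have "norm (y /\<^sub>R norm y) = 1" "u \<bullet> (y /\<^sub>R norm y) = 0"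
    by (auto simp: orthogonal_def)
  from orthonormal_frame[OF assms this] that show thesis by blast
qed

lemma prod_UNIV_3: "prod f (UNIV :: 3 set) = f 1 * f 2 * f 3"
  unfolding UNIV_3 by (simp add: mult.assoc)

lemma measure_le_box:
  fixes f :: "real^3 \<Rightarrow> real^3"
  assumes f: "orthogonal_transformation f" and S: "S \<in> lmeasurable"
    and box: "\<And>x. x \<in> S \<Longrightarrow> \<bar>f x $ 1\<bar> \<le> a \<and> \<bar>f x $ 2\<bar> \<le> b \<and> \<bar>f x $ 3\<bar> \<le> c"
    and nonneg: "0 \<le> a" "0 \<le> b" "0 \<le> c"
  shows "measure lebesgue S \<le> 8 * a * b * c"
proof -
  define p :: "real^3" where "p = vector [a, b, c]"
  have sub: "f ` S \<subseteq> cbox (- p) p"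
    using box by (fastforce simp: mem_box_cart forall_3 p_def abs_le_iff)
  have "cbox (- p) p \<noteq> {}"
    using nonneg by (auto simp: p_def interval_ne_empty_cart forall_3)
  then have box_vol: "measure lebesgue (cbox (- p) p) = 8 * a * b * c"
    by (simp add: content_cbox_cart prod_UNIV_3 p_def)
  have "measure lebesgue S = measure lebesgue (f ` S)"
    using measure_orthogonal_image[OF f S] by simp
  also have "\<dots> \<le> measure lebesgue (cbox (- p) p)"
    using measurable_orthogonal_image[OF f S] sub
    by (intro measure_mono_fmeasurable) auto
  finally show ?thesis using box_vol by simp
qed

text \<open>A slab of constant thickness is easier to box in than a cone. The lower cut at 1/2 keeps
  the set away from the apex, so that it fits into a cone; the upper cut keeps it bounded.\<close>

definition band :: "real \<Rightarrow> real^3 \<Rightarrow> (real^3) set" where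
  "band \<delta> u = {x. 1 / 2 \<le> norm x \<and> norm x \<le> 1 \<and> \<bar>u \<bullet> x\<bar> \<le> \<delta>}"

lemma compact_band: "compact (band \<delta> u)"
proof -
  have "closed (band \<delta> u)"
    unfolding band_def by (intro closed_Collect_conj closed_Collect_le continuous_intros)
  moreover have "band \<delta> u \<subseteq> cball 0 1" by (auto simp: band_def)
  ultimately show ?thesis
    by (meson bounded_cball bounded_subset compact_eq_bounded_closed)
qed

lemma lmeasurable_band: "band \<delta> u \<in> lmeasurable"
  by (simp add: compact_band lmeasurable_compact)

lemma measure_band_ge:
  assumes u: "norm u = 1" and \<delta>: "0 \<le> \<delta>" "\<delta> \<le> 1 / 4"
  shows "\<delta> / 8 \<le> measure lebesgue (band \<delta> u)"
proof -
  obtain f :: "real^3 \<Rightarrow> real^3" where f: "orthogonal_transformation f" "\<And>x. f x $ 1 = u \<bullet> x"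
    using orthonormal_frame_exists[OF u] by blast
  \<comment> \<open>This box has volume \<open>\<delta> / 8\<close>. Its second coordinate alone
    forces norm at least 1/2, and since \<open>\<delta> \<le> 1 / 4\<close> the squared norm is at
    most 1/16 + 9/16 + 1/16 < 1.\<close>
  define p q :: "real^3" where "p = vector [- \<delta>, 1 / 2, 0]" and "q = vector [\<delta>, 3 / 4, 1 / 4]"
  have sub: "cbox p q \<subseteq> f ` band \<delta> u"
  proof
    fix y assume "y \<in> cbox p q"
    then have y: "\<bar>y $ 1\<bar> \<le> \<delta>" "1 / 2 \<le> y $ 2" "y $ 2 \<le> 3 / 4" "0 \<le> y $ 3" "y $ 3 \<le> 1 / 4"
      by (auto simp: mem_box_cart forall_3 p_def q_def)
    obtain x where x: "y = f x"
      using orthogonal_transformation_surj[OF f(1)] by (meson surjD)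
    have "(norm x)\<^sup>2 = (norm y)\<^sup>2"
      using f(1) x by (simp add: orthogonal_transformation_norm)
    also have "\<dots> = (y $ 1)\<^sup>2 + (y $ 2)\<^sup>2 + (y $ 3)\<^sup>2"
      unfolding power2_norm_eq_inner inner_vec_def sum_3 by (simp add: power2_eq_square)
    finally have nx: "(norm x)\<^sup>2 = (y $ 1)\<^sup>2 + (y $ 2)\<^sup>2 + (y $ 3)\<^sup>2" .
    have "(y $ 1)\<^sup>2 \<le> (1 / 4)\<^sup>2" "(y $ 2)\<^sup>2 \<le> (3 / 4)\<^sup>2" "(y $ 3)\<^sup>2 \<le> (1 / 4)\<^sup>2"
      using y \<delta> by (auto intro!: power2_le_iff_abs_le[THEN iffD2])
    then have "(norm x)\<^sup>2 \<le> 1\<^sup>2" unfolding nx by (simp add: power2_eq_square)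
    moreover have "(1 / 2)\<^sup>2 \<le> (y $ 2)\<^sup>2" using y by (intro power_mono) auto
    then have "(1 / 2)\<^sup>2 \<le> (norm x)\<^sup>2" unfolding nx by (smt (verit) zero_le_power2)
    ultimately have "norm x \<le> 1" "1 / 2 \<le> norm x"
      by (auto intro: power2_le_imp_le)
    then show "y \<in> f ` band \<delta> u" using x y f(2)[of x] by (auto simp: band_def)
  qed
  have "cbox p q \<noteq> {}"
    using \<delta> by (auto simp: p_def q_def interval_ne_empty_cart forall_3)
  then have "measure lebesgue (cbox p q) = \<delta> / 8"
    by (simp add: content_cbox_cart prod_UNIV_3 p_def q_def)
  moreover have "measure lebesgue (cbox p q) \<le> measure lebesgue (f ` band \<delta> u)"
    using sub measurable_orthogonal_image[OF f(1) lmeasurable_band]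
    by (intro measure_mono_fmeasurable) auto
  ultimately show ?thesis
    using measure_orthogonal_image[OF f(1) lmeasurable_band] by simp
qed

lemma measure_band_le:
  assumes u: "norm u = 1" and \<delta>: "0 \<le> \<delta>"
  shows "measure lebesgue (band \<delta> u) \<le> 8 * \<delta>"
proof -
  obtain f :: "real^3 \<Rightarrow> real^3" where f: "orthogonal_transformation f" "\<And>x. f x $ 1 = u \<bullet> x"
    using orthonormal_frame_exists[OF u] by blast
  have "\<bar>f x $ k\<bar> \<le> 1" if "x \<in> band \<delta> u" for x k
  proof -
    have "\<bar>f x $ k\<bar> \<le> norm (f x)" by (rule component_le_norm_cart)
    also have "\<dots> \<le> 1" using that f(1) by (simp add: orthogonal_transformation_norm band_def)
    finally show ?thesis .
  qed
  then have "measure lebesgue (band \<delta> u) \<le> 8 * \<delta> * 1 * 1"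
    by (intro measure_le_box[OF f(1) lmeasurable_band]) (auto simp: \<delta> f(2) band_def)
  then show ?thesis by simp
qed

text \<open>In the orthonormal frame whose first vectors span \<open>u\<close> and \<open>v\<close>, the intersection of the two
  slabs lies in a box: with \<open>v = c u + s w\<close>, \<open>\<bar>w \<bullet> x\<bar> = \<bar>v \<bullet> x - c (u \<bullet> x)\<bar> / s \<le> 2 \<delta> / s\<close>.\<close>
lemma measure_band_Int_le:
  assumes u: "norm u = 1" and v: "norm v = 1" and \<delta>: "0 \<le> \<delta>"
    and s: "s = sqrt (1 - (u \<bullet> v)\<^sup>2)" "s > 0"
  shows "measure lebesgue (band \<delta> u \<inter> band \<delta> v) \<le> 16 * \<delta>\<^sup>2 / s"
proof -
  define c where "c = u \<bullet> v"
  define w where "w = (v - c *\<^sub>R u) /\<^sub>R s"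
  have c1: "\<bar>c\<bar> \<le> 1" using Cauchy_Schwarz_ineq2[of u v] u v by (simp add: c_def)
  have uu: "u \<bullet> u = 1" "v \<bullet> v = 1" using u v by (simp_all add: norm_eq_1)
  have s2: "s\<^sup>2 = 1 - c\<^sup>2"
    using s by (simp add: c_def)
  have "(v - c *\<^sub>R u) \<bullet> (v - c *\<^sub>R u) = s\<^sup>2"
    unfolding s2 using uu by (simp add: c_def inner_commute power2_eq_square algebra_simps)
  then have "norm (v - c *\<^sub>R u) = s" using s by (simp add: norm_eq_square)
  then have nw: "norm w = 1" using s by (simp add: w_def)
  have "u \<bullet> w = 0" using uu by (simp add: w_def c_def algebra_simps)
  then obtain f :: "real^3 \<Rightarrow> real^3" where f: "orthogonal_transformation f"
    "\<And>x. f x $ 1 = u \<bullet> x" "\<And>x. f x $ 2 = w \<bullet> x"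
    using orthonormal_frame[OF u nw] by blast
  have *: "\<bar>f x $ 1\<bar> \<le> \<delta> \<and> \<bar>f x $ 2\<bar> \<le> 2 * \<delta> / s \<and> \<bar>f x $ 3\<bar> \<le> 1"
    if x: "x \<in> band \<delta> u \<inter> band \<delta> v" for x
  proof (intro conjI)
    have d: "\<bar>u \<bullet> x\<bar> \<le> \<delta>" "\<bar>v \<bullet> x\<bar> \<le> \<delta>" using x by (auto simp: band_def)
    then show "\<bar>f x $ 1\<bar> \<le> \<delta>" by (simp add: f)
    have "\<bar>c * (u \<bullet> x)\<bar> \<le> 1 * \<delta>"
      unfolding abs_mult using c1 d by (intro mult_mono) auto
    then have "\<bar>v \<bullet> x - c * (u \<bullet> x)\<bar> \<le> 2 * \<delta>" using d by linarith
    moreover have "w \<bullet> x = (v \<bullet> x - c * (u \<bullet> x)) / s"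
      by (simp add: w_def algebra_simps divide_inverse)
    ultimately show "\<bar>f x $ 2\<bar> \<le> 2 * \<delta> / s"
      using s by (simp add: f abs_divide divide_right_mono)
    have "\<bar>f x $ 3\<bar> \<le> norm (f x)" by (rule component_le_norm_cart)
    also have "\<dots> \<le> 1" using x f(1) by (simp add: orthogonal_transformation_norm band_def)
    finally show "\<bar>f x $ 3\<bar> \<le> 1" .
  qed
  have "measure lebesgue (band \<delta> u \<inter> band \<delta> v) \<le> 8 * \<delta> * (2 * \<delta> / s) * 1"
    using \<delta> s by (intro measure_le_box[OF f(1) fmeasurable.Int[OF lmeasurable_band lmeasurable_band] *]) auto
  then show ?thesis by (simp add: power2_eq_square)
qed

section \<open>Second moment inequality for finite unions\<close>

text \<open>The second moment method: integrate \<open>2 \<lambda> N - \<lambda>\<^sup>2 N\<^sup>2 \<le> 1\<close>, where \<open>N\<close> counts the sets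
  containing a given point.\<close>
lemma measure_UN_ge_second_moment:
  fixes A :: "'i \<Rightarrow> 'a set" and l :: real
  assumes I: "finite I" and A: "\<And>i. i \<in> I \<Longrightarrow> A i \<in> fmeasurable M"
  shows "2 * l * (\<Sum>i\<in>I. measure M (A i)) - l\<^sup>2 * (\<Sum>i\<in>I. \<Sum>j\<in>I. measure M (A i \<inter> A j))
    \<le> measure M (\<Union>i\<in>I. A i)"
proof -
  define N :: "'a \<Rightarrow> real" where "N x = (\<Sum>i\<in>I. indicator (A i) x)" for x
  have ind: "has_bochner_integral M (indicator S :: 'a \<Rightarrow> real) (measure M S)"
    if "S \<in> fmeasurable M" for S
    using that by (intro has_bochner_integral_real_indicator) (auto simp: fmeasurable_def)
  have N2: "(N x)\<^sup>2 = (\<Sum>i\<in>I. \<Sum>j\<in>I. indicator (A i \<inter> A j) x)" for x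
    by (simp add: N_def power2_eq_square sum_product indicator_inter_arith)
  have int: "has_bochner_integral M (\<lambda>x. 2 * l * N x - l\<^sup>2 * (N x)\<^sup>2)
      (2 * l * (\<Sum>i\<in>I. measure M (A i)) - l\<^sup>2 * (\<Sum>i\<in>I. \<Sum>j\<in>I. measure M (A i \<inter> A j)))"
    unfolding N2 unfolding N_def
    by (intro has_bochner_integral_diff has_bochner_integral_mult_right
        has_bochner_integral_sum ind A fmeasurable.Int)
  have U: "(\<Union>i\<in>I. A i) \<in> fmeasurable M"
    using A I by (intro fmeasurable.finite_UN) auto
  have "(\<integral>x. 2 * l * N x - l\<^sup>2 * (N x)\<^sup>2 \<partial>M) \<le> (\<integral>x. indicator (\<Union>i\<in>I. A i) x \<partial>M)"
  proof (rule integral_mono)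
    show "integrable M (\<lambda>x. 2 * l * N x - l\<^sup>2 * (N x)\<^sup>2)"
      "integrable M (indicator (\<Union>i\<in>I. A i) :: 'a \<Rightarrow> real)"
      using int ind[OF U] by (auto simp: has_bochner_integral_iff)
  next
    fix x
    show "2 * l * N x - l\<^sup>2 * (N x)\<^sup>2 \<le> indicator (\<Union>i\<in>I. A i) x"
    proof (cases "x \<in> (\<Union>i\<in>I. A i)")
      case True
      \<comment> \<open>On the union the pointwise bound is the nonnegativity of this square; off
        the union both sides vanish.\<close>
      have "0 \<le> (1 - l * N x)\<^sup>2" by simp
      with True show ?thesis by (simp add: power2_eq_square algebra_simps)
    next
      case False
      then have "N x = 0" by (auto simp: N_def intro!: sum.neutral)
      with False show ?thesis by simp
    qed
  qed
  then show ?thesis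
    unfolding has_bochner_integral_integral_eq[OF int] has_bochner_integral_integral_eq[OF ind[OF U]] .
qed

section \<open>Neighborhoods of great circles\<close>

text \<open>Taylor's bound gives sin x at least x - x^3/6, hence at least 5x/6 on [0, 1]. It serves
  both the radius of the neighborhoods and the angles between the planes.\<close>

lemma half_le_sin:
  fixes x :: real
  assumes "0 \<le> x" "x \<le> 1"
  shows "x / 2 \<le> sin x"
proof -
  have "\<bar>sin x - (\<Sum>m<3. sin_coeff m * x ^ m)\<bar> \<le> inverse (fact 3) * \<bar>x\<bar> ^ 3"
    by (rule Maclaurin_sin_bound)
  also have "(\<Sum>m<3. sin_coeff m * x ^ m) = x"
    by (simp add: numeral_3_eq_3 sin_coeff_def)
  also have "inverse (fact 3) * \<bar>x\<bar> ^ 3 = x ^ 3 / 6"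
    using assms by (simp add: fact_numeral)
  finally have "x - x ^ 3 / 6 \<le> sin x" by linarith
  moreover have "x ^ 3 \<le> x" using assms power_decreasing[of 1 3 x] by simp
  ultimately show ?thesis using assms by linarith
qed

lemma plane_eq_orthogonal_complement:
  assumes P: "plane_through_origin P" and u: "unit_normal P u"
  shows "P = {x. u \<bullet> x = 0}"
proof (rule subspace_dim_equal)
  show "subspace P" using P by (simp add: plane_through_origin_def)
  show "subspace {x. u \<bullet> x = 0}" by (rule subspace_hyperplane)
  show "P \<subseteq> {x. u \<bullet> x = 0}" using u by (auto simp: unit_normal_def orthogonal_def)
  have "u \<noteq> 0" using u by (auto simp: unit_normal_def)
  then show "dim {x. u \<bullet> x = 0} \<le> dim P"
    using P by (simp add: dim_hyperplane plane_through_origin_def)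
qed

text \<open>The point of the circle nearest to \<open>x\<close> is the normalized projection
  \<open>q\<close> of \<open>x\<close> to the plane, at distance \<open>arccos (norm q)\<close>.
  Since \<open>norm q\<close> squared is 1 minus the square of \<open>u \<bullet> x\<close>,
  distance at most \<open>r\<close> means \<open>norm q \<ge> cos r\<close>, that is,
  \<open>\<bar>u \<bullet> x\<bar> \<le> sin r\<close>.\<close>

lemma geodesic_nbhd_great_circle:
  assumes P: "plane_through_origin P" and u: "unit_normal P u"
    and r: "0 \<le> r" "r < pi / 2"
  shows "geodesic_nbhd r (S2 \<inter> P) = {x \<in> S2. \<bar>u \<bullet> x\<bar> \<le> sin r}"
proof -
  let ?G = "S2 \<inter> P"
  have P_eq: "P = {x. u \<bullet> x = 0}" by (rule plane_eq_orthogonal_complement[OF P u])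
  have nu: "norm u = 1" using u by (simp add: unit_normal_def)
  then have uu: "u \<bullet> u = 1" by (simp add: norm_eq_1)
  have cos_pos: "0 < cos r" using r by (intro cos_gt_zero_pi) auto
  have sin_nn: "0 \<le> sin r" using r pi_gt_zero by (intro sin_ge_zero) linarith+
  have ne: "?G \<noteq> {}"
  proof -
    obtain y where "y \<noteq> 0" "orthogonal u y"
      using orthogonal_to_vector_exists[of u] by auto
    then have "y /\<^sub>R norm y \<in> ?G" by (auto simp: P_eq orthogonal_def)
    then show ?thesis by blast
  qed
  have "(INF y\<in>?G. geodesic_dist x y) \<le> r \<longleftrightarrow> \<bar>u \<bullet> x\<bar> \<le> sin r" if x: "x \<in> S2" for x
  proof -
    define q where "q = x - (u \<bullet> x) *\<^sub>R u"
    have xx: "x \<bullet> x = 1" using x by (simp add: norm_eq_1)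
    have uq: "u \<bullet> q = 0" using uu by (simp add: q_def algebra_simps)
    have nq: "(norm q)\<^sup>2 = 1 - (u \<bullet> x)\<^sup>2"
      unfolding power2_norm_eq_inner q_def using uu xx
      by (simp add: inner_commute power2_eq_square algebra_simps)
    then have "(norm q)\<^sup>2 \<le> 1\<^sup>2" by simp
    then have nq1: "norm q \<le> 1" by (rule power2_le_imp_le) simp
    have cs: "\<bar>x \<bullet> y\<bar> \<le> 1" if "y \<in> ?G" for y
      using Cauchy_Schwarz_ineq2[of x y] x that by simp
    have xq: "x \<bullet> y = q \<bullet> y" if "y \<in> ?G" for y
      using that by (simp add: q_def P_eq algebra_simps)
    have "cos r \<le> norm q \<longleftrightarrow> (cos r)\<^sup>2 \<le> (norm q)\<^sup>2"
      using cos_pos by (simp add: power_mono_iff)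
    also have "\<dots> \<longleftrightarrow> (u \<bullet> x)\<^sup>2 \<le> (sin r)\<^sup>2"
      unfolding nq cos_squared_eq by auto
    also have "\<dots> \<longleftrightarrow> \<bar>u \<bullet> x\<bar> \<le> sin r"
      using sin_nn by (simp add: power2_le_iff_abs_le)
    finally have key: "cos r \<le> norm q \<longleftrightarrow> \<bar>u \<bullet> x\<bar> \<le> sin r" .
    show ?thesis
    proof
      assume le: "(INF y\<in>?G. geodesic_dist x y) \<le> r"
      have "arccos (norm q) \<le> (INF y\<in>?G. geodesic_dist x y)"
      proof (rule cINF_greatest[OF ne])
        fix y assume y: "y \<in> ?G"
        have "x \<bullet> y \<le> norm q" using norm_cauchy_schwarz[of q y] y xq[OF y] by simp
        then show "arccos (norm q) \<le> geodesic_dist x y"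
          unfolding geodesic_dist_def using cs[OF y] nq1 by (intro arccos_le_arccos) auto
      qed
      with le have "arccos (norm q) \<le> arccos (cos r)" using r by (simp add: arccos_cos)
      then have "cos r \<le> norm q"
        using nq1 by (subst (asm) arccos_le_mono) auto
      then show "\<bar>u \<bullet> x\<bar> \<le> sin r" by (simp add: key)
    next
      assume "\<bar>u \<bullet> x\<bar> \<le> sin r"
      then have ge: "cos r \<le> norm q" by (simp add: key)
      \<comment> \<open>Because \<open>r < pi / 2\<close>, the poles, where \<open>q = 0\<close>
        cannot be normalized, are excluded here.\<close>
      with cos_pos have q0: "norm q > 0" by linarith
      define y where "y = q /\<^sub>R norm q"
      have y: "y \<in> ?G" using q0 uq by (simp add: y_def P_eq)
      have "x \<bullet> y = norm q"
        unfolding xq[OF y] using q0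
        by (simp add: y_def power2_norm_eq_inner[symmetric] power2_eq_square)
      then have "geodesic_dist x y \<le> arccos (cos r)"
        unfolding geodesic_dist_def using ge nq1 cos_pos by (intro arccos_le_arccos) auto
      also have "\<dots> = r" using r by (simp add: arccos_cos)
      finally have "geodesic_dist x y \<le> r" .
      moreover have "(INF y\<in>?G. geodesic_dist x y) \<le> geodesic_dist x y"
      proof (rule cINF_lower[OF _ y])
        show "bdd_below (geodesic_dist x ` ?G)"
          using cs by (auto simp: geodesic_dist_def abs_le_iff intro!: bdd_belowI2[of _ 0] arccos_lbound)
      qed
      ultimately show "(INF y\<in>?G. geodesic_dist x y) \<le> r" by linarith
    qed
  qed
  then show ?thesis by (auto simp: geodesic_nbhd_def)
qed

section \<open>Solid cones over neighborhoods: measurability and comparison with bands\<close>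

text \<open>The origin is excluded because it does not belong to the cone over the empty set.\<close>
lemma solid_cone_circle_nbhd:
  fixes u :: "real^3"
  shows "solid_cone {x \<in> S2. \<bar>u \<bullet> x\<bar> \<le> s} \<subseteq> {x. norm x \<le> 1 \<and> \<bar>u \<bullet> x\<bar> \<le> s * norm x}"
    and "{x. norm x \<le> 1 \<and> \<bar>u \<bullet> x\<bar> \<le> s * norm x} - {0} \<subseteq> solid_cone {x \<in> S2. \<bar>u \<bullet> x\<bar> \<le> s}"
proof -
  show "solid_cone {x \<in> S2. \<bar>u \<bullet> x\<bar> \<le> s} \<subseteq> {x. norm x \<le> 1 \<and> \<bar>u \<bullet> x\<bar> \<le> s * norm x}"
    by (auto simp: solid_cone_def abs_mult mult.commute intro!: mult_left_mono)
  show "{x. norm x \<le> 1 \<and> \<bar>u \<bullet> x\<bar> \<le> s * norm x} - {0} \<subseteq> solid_cone {x \<in> S2. \<bar>u \<bullet> x\<bar> \<le> s}"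
  proof
    fix x assume "x \<in> {x. norm x \<le> 1 \<and> \<bar>u \<bullet> x\<bar> \<le> s * norm x} - {0}"
    then show "x \<in> solid_cone {x \<in> S2. \<bar>u \<bullet> x\<bar> \<le> s}"
      by (auto simp: solid_cone_def abs_mult field_simps
          intro!: exI[of _ "norm x"] exI[of _ "x /\<^sub>R norm x"])
  qed
qed

lemma solid_cone_UN: "solid_cone (\<Union>i\<in>I. A i) = (\<Union>i\<in>I. solid_cone (A i))"
  by (auto simp: solid_cone_def)

text \<open>The cone lies between the compact set \<open>K\<close> and \<open>K - {0}\<close>, so it
  equals one of the two.\<close>

lemma lmeasurable_solid_cone_circle_nbhd:
  fixes u :: "real^3"
  shows "solid_cone {x \<in> S2. \<bar>u \<bullet> x\<bar> \<le> s} \<in> lmeasurable"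
proof -
  define K where "K = {x. norm x \<le> 1 \<and> \<bar>u \<bullet> x\<bar> \<le> s * norm x}"
  have "closed K"
    unfolding K_def by (intro closed_Collect_conj closed_Collect_le continuous_intros)
  moreover have "K \<subseteq> cball 0 1" by (auto simp: K_def)
  ultimately have "compact K"
    by (meson bounded_cball bounded_subset compact_eq_bounded_closed)
  then have K: "K \<in> lmeasurable" by (rule lmeasurable_compact)
  have "solid_cone {x \<in> S2. \<bar>u \<bullet> x\<bar> \<le> s} = K \<or> solid_cone {x \<in> S2. \<bar>u \<bullet> x\<bar> \<le> s} = K - {0}"
    using solid_cone_circle_nbhd[of u s] unfolding K_def[symmetric] by blast
  moreover have "K - {0} \<in> lmeasurable"
    by (rule fmeasurable.Diff[OF K lmeasurable_compact]) simp
  ultimately show ?thesis using K by (elim disjE) simp_all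
qed

text \<open>The cut \<open>norm x \<ge> 1 / 2\<close> costs exactly the factor 2:
  \<open>\<delta> \<le> s / 2 \<le> s * norm x\<close>.\<close>

lemma band_subset_solid_cone:
  assumes "0 \<le> \<delta>" "2 * \<delta> \<le> s"
  shows "band \<delta> u \<subseteq> solid_cone {x \<in> S2. \<bar>u \<bullet> x\<bar> \<le> s}"
proof -
  have "\<bar>u \<bullet> x\<bar> \<le> s * norm x" "x \<noteq> 0" if "x \<in> band \<delta> u" for x
  proof -
    have "\<delta> = (2 * \<delta>) * (1 / 2)" by simp
    also have "\<dots> \<le> s * norm x" using that assms by (intro mult_mono) (auto simp: band_def)
    finally show "\<bar>u \<bullet> x\<bar> \<le> s * norm x" using that by (simp add: band_def)
    show "x \<noteq> 0" using that by (auto simp: band_def)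
  qed
  then have "band \<delta> u \<subseteq> {x. norm x \<le> 1 \<and> \<bar>u \<bullet> x\<bar> \<le> s * norm x} - {0}"
    by (auto simp: band_def)
  then show ?thesis using solid_cone_circle_nbhd(2) by blast
qed

lemma surface_area_circle_nbhds_ge:
  assumes "finite I" "0 \<le> \<delta>" "2 * \<delta> \<le> s"
  shows "3 * measure lebesgue (\<Union>i\<in>I. band \<delta> (u i))
    \<le> surface_area (\<Union>i\<in>I. {x \<in> S2. \<bar>u i \<bullet> x\<bar> \<le> s})"
proof -
  have "measure lebesgue (\<Union>i\<in>I. band \<delta> (u i))
    \<le> measure lebesgue (\<Union>i\<in>I. solid_cone {x \<in> S2. \<bar>u i \<bullet> x\<bar> \<le> s})"
  proof (rule measure_mono_fmeasurable)
    show "(\<Union>i\<in>I. band \<delta> (u i)) \<subseteq> (\<Union>i\<in>I. solid_cone {x \<in> S2. \<bar>u i \<bullet> x\<bar> \<le> s})"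
      using band_subset_solid_cone assms by (intro UN_mono) auto
    show "(\<Union>i\<in>I. band \<delta> (u i)) \<in> sets lebesgue"
      using assms lmeasurable_band by (intro sets.finite_UN) (auto simp: fmeasurableD)
    show "(\<Union>i\<in>I. solid_cone {x \<in> S2. \<bar>u i \<bullet> x\<bar> \<le> s}) \<in> lmeasurable"
      using assms lmeasurable_solid_cone_circle_nbhd by (intro fmeasurable.finite_UN) auto
  qed
  then show ?thesis by (simp add: surface_area_def solid_cone_UN)
qed

section \<open>Packing\<close>

text \<open>The right-hand side telescopes. Passing from \<open>K\<close> to \<open>Suc K\<close>
  adds two terms, in total \<open>2 / y\<close>, while the bound grows by 4 (y - x) = 4 / (y + x),
  which is at least \<open>2 / y\<close>.\<close>

lemma sum_inverse_sqrt_int_le: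
  "(\<Sum>a\<in>{- int K..int K}. 1 / sqrt (1 + \<bar>real_of_int a\<bar>)) \<le> 4 * sqrt (real K + 1)"
proof (induction K)
  case 0
  show ?case by simp
next
  case (Suc K)
  have split: "{- int (Suc K)..int (Suc K)} =
      insert (- int (Suc K)) (insert (int (Suc K)) {- int K..int K})" by auto
  define x y where "x = sqrt (real K + 1)" and "y = sqrt (real K + 2)"
  have xy: "0 < x" "x \<le> y" "y * y - x * x = 1" by (auto simp: x_def y_def)
  have "2 \<le> 4 * y * (y - x)"
  proof -
    have "1 = (y + x) * (y - x)" using xy(3) by (simp add: algebra_simps)
    also have "\<dots> \<le> (2 * y) * (y - x)" using xy by (intro mult_right_mono) auto
    finally show ?thesis by (simp add: algebra_simps)
  qed
  then have "2 / y \<le> 4 * y - 4 * x" using xy by (simp add: field_simps)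
  moreover have "(\<Sum>a\<in>{- int (Suc K)..int (Suc K)}. 1 / sqrt (1 + \<bar>real_of_int a\<bar>))
      = 2 / y + (\<Sum>a\<in>{- int K..int K}. 1 / sqrt (1 + \<bar>real_of_int a\<bar>))"
    unfolding split by (subst sum.insert; simp add: y_def add.commute)
  ultimately show ?case using Suc by (simp add: x_def y_def add.commute)
qed

text \<open>Each cell of the grid of side \<open>h\<close> contains at most one of the points, and the bound
  \<open>1 / (1 + max \<bar>a\<bar> \<bar>b\<bar>) \<le> 1 / (sqrt (1 + \<bar>a\<bar>) * sqrt (1 + \<bar>b\<bar>))\<close> makes the sum over
  the cells \<open>(a, b)\<close> a product of one-dimensional sums.\<close>
lemma sum_inverse_norm_separated_le:
  fixes p :: "'i \<Rightarrow> complex"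
  assumes I: "finite I" and h: "0 < h"
    and sep: "\<And>i j. i \<in> I \<Longrightarrow> j \<in> I \<Longrightarrow> i \<noteq> j \<Longrightarrow> 2 * h\<^sup>2 \<le> (norm (p i - p j))\<^sup>2"
    and lower: "\<And>i. i \<in> I \<Longrightarrow> 2 * h \<le> norm (p i)"
    and upper: "\<And>i. i \<in> I \<Longrightarrow> norm (p i) \<le> 1"
  shows "(\<Sum>i\<in>I. 1 / norm (p i)) \<le> 32 * (1 / h + 3) / h"
proof -
  define cell where "cell i = (\<lfloor>Re (p i) / h\<rfloor>, \<lfloor>Im (p i) / h\<rfloor>)" for i
  define g :: "int \<Rightarrow> real" where "g a = 1 / sqrt (1 + \<bar>real_of_int a\<bar>)" for a
  \<comment> \<open>The extra 1 absorbs the rounding of negative coordinates: cell indices can reach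
    \<open>1 / h + 1\<close> in absolute value.\<close>
  define K where "K = nat \<lceil>1 / h\<rceil> + 1"
  have g0: "0 \<le> g a" for a by (simp add: g_def)
  have K: "1 / h + 1 \<le> real K" "real K \<le> 1 / h + 2"
    using h by (auto simp: K_def of_nat_nat le_of_int_ceiling intro: less_imp_le)
      (use ceiling_correct[of "1 / h"] in linarith)
  have inj: "inj_on cell I"
  proof (rule inj_onI, rule ccontr)
    fix i j assume ij: "i \<in> I" "j \<in> I" "cell i = cell j" "i \<noteq> j"
    \<comment> \<open>Two points in one cell differ by less than \<open>h\<close> in each
      coordinate, so their squared distance is strictly below the assumed separation.\<close>
    have near: "(x - y)\<^sup>2 < h\<^sup>2" if "\<lfloor>x / h\<rfloor> = \<lfloor>y / h\<rfloor>" for x y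
    proof -
      have "\<bar>x / h - y / h\<bar> < 1" using that by linarith
      then have "\<bar>x - y\<bar> < h" using h by (simp add: diff_divide_distrib[symmetric] abs_divide)
      then have "\<bar>x - y\<bar>\<^sup>2 < h\<^sup>2" by (intro power_strict_mono) auto
      then show ?thesis by simp
    qed
    have "(norm (p i - p j))\<^sup>2 = (Re (p i) - Re (p j))\<^sup>2 + (Im (p i) - Im (p j))\<^sup>2"
      by (simp add: cmod_power2)
    also have "\<dots> < h\<^sup>2 + h\<^sup>2"
      using ij by (intro add_strict_mono near) (auto simp: cell_def)
    finally show False using sep[of i j] ij by simp
  qed
  have floor_le: "\<bar>real_of_int \<lfloor>x / h\<rfloor>\<bar> \<le> \<bar>x\<bar> / h + 1" for x
  proof -
    have "\<bar>x / h\<bar> = \<bar>x\<bar> / h" using h by (simp add: abs_divide)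
    then show ?thesis by linarith
  qed
  have coord: "\<bar>real_of_int (fst (cell i))\<bar> \<le> norm (p i) / h + 1"
    "\<bar>real_of_int (snd (cell i))\<bar> \<le> norm (p i) / h + 1" for i
    using floor_le[of "Re (p i)"] floor_le[of "Im (p i)"] h
      divide_right_mono[OF abs_Re_le_cmod, of h "p i"] divide_right_mono[OF abs_Im_le_cmod, of h "p i"]
    by (auto simp: cell_def)
  have term_le: "1 / norm (p i) \<le> 2 / h * (g (fst (cell i)) * g (snd (cell i)))" if i: "i \<in> I" for i
  proof -
    define a b where "a = 1 + \<bar>real_of_int (fst (cell i))\<bar>" and "b = 1 + \<bar>real_of_int (snd (cell i))\<bar>"
    define M where "M = 2 * norm (p i) / h"
    \<comment> \<open>Distance at least \<open>2 * h\<close> from the origin absorbs both the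
      rounding and the shift by 1: \<open>a\<close> and \<open>b\<close> are at most
      \<open>norm (p i) / h + 2\<close>, hence at most \<open>M\<close>.\<close>
    have "2 \<le> norm (p i) / h" using lower[OF i] h by (simp add: field_simps)
    then have ab: "0 < a" "a \<le> M" "0 < b" "b \<le> M" and M: "0 < M"
      using coord[of i] by (auto simp: a_def b_def M_def)
    have "a * b \<le> M * M" using ab M by (intro mult_mono) auto
    then have "sqrt (a * b) \<le> M" using M by (simp add: real_le_lsqrt power2_eq_square)
    then have "1 / M \<le> 1 / sqrt (a * b)" using ab M by (intro divide_left_mono) auto
    also have "\<dots> = g (fst (cell i)) * g (snd (cell i))"
      by (simp add: g_def a_def b_def real_sqrt_mult)
    finally have *: "1 / M \<le> g (fst (cell i)) * g (snd (cell i))" .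
    have "1 / norm (p i) = 2 / h * (1 / M)" using h by (simp add: M_def)
    also have "\<dots> \<le> 2 / h * (g (fst (cell i)) * g (snd (cell i)))"
      using * h by (intro mult_left_mono) auto
    finally show ?thesis .
  qed
  have cells: "cell ` I \<subseteq> {- int K..int K} \<times> {- int K..int K}"
  proof
    fix c assume "c \<in> cell ` I"
    then obtain i where i: "i \<in> I" "c = cell i" by blast
    have "norm (p i) / h \<le> 1 / h" using upper[OF i(1)] h by (intro divide_right_mono) auto
    then have "\<bar>real_of_int (fst c)\<bar> \<le> real K" "\<bar>real_of_int (snd c)\<bar> \<le> real K"
      using coord[of i] K i by auto
    then have "\<bar>fst c\<bar> \<le> int K" "\<bar>snd c\<bar> \<le> int K" by linarith+
    then show "c \<in> {- int K..int K} \<times> {- int K..int K}" by (auto simp: mem_Times_iff)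
  qed
  define s where "s = (\<Sum>a\<in>{- int K..int K}. g a)"
  have "(\<Sum>i\<in>I. 1 / norm (p i)) \<le> (\<Sum>i\<in>I. 2 / h * (g (fst (cell i)) * g (snd (cell i))))"
    by (intro sum_mono term_le)
  also have "\<dots> = (\<Sum>c\<in>cell ` I. 2 / h * (g (fst c) * g (snd c)))"
    by (simp add: sum.reindex[OF inj])
  \<comment> \<open>All terms are nonnegative, so the sum may run over the full square grid, where
    it factors as \<open>s\<close> times \<open>s\<close>.\<close>
  also have "\<dots> \<le> (\<Sum>c\<in>{- int K..int K} \<times> {- int K..int K}. 2 / h * (g (fst c) * g (snd c)))"
    using cells h g0 by (intro sum_mono2) (auto intro!: mult_nonneg_nonneg)
  also have "\<dots> = 2 / h * s\<^sup>2"
    unfolding s_def power2_eq_square sum_product sum.cartesian_product case_prod_unfold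
    by (simp only: sum_distrib_left)
  also have "\<dots> \<le> 2 / h * (4 * sqrt (real K + 1))\<^sup>2"
    using sum_inverse_sqrt_int_le[of K] h g0
    by (intro mult_left_mono power_mono) (auto simp: s_def g_def[abs_def] sum_nonneg)
  also have "\<dots> = 2 / h * (16 * (real K + 1))" by (simp add: power_mult_distrib)
  also have "\<dots> \<le> 2 / h * (16 * (1 / h + 3))"
    using K h by (intro mult_left_mono) auto
  finally show ?thesis by simp
qed

text \<open>Lines at angle at most \<open>pi / 4\<close> to \<open>w\<close> are, after choosing the orientation with
  \<open>w \<bullet> u i \<ge> 0\<close>, projected to the plane orthogonal to \<open>w\<close> with distortion at most \<open>sqrt 2\<close>;
  all the others contribute at most \<open>sqrt 2\<close> each.\<close>
lemma sum_inverse_sin_separated_le: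
  fixes u :: "'i \<Rightarrow> real^3"
  assumes I: "finite I" and \<sigma>: "0 < \<sigma>" and w: "norm w = 1"
    and u: "\<And>i. i \<in> I \<Longrightarrow> norm (u i) = 1"
    and sep: "\<And>i j. i \<in> I \<Longrightarrow> j \<in> I \<Longrightarrow> i \<noteq> j \<Longrightarrow> \<sigma>\<^sup>2 \<le> 1 - (u i \<bullet> u j)\<^sup>2"
    and sep_w: "\<And>i. i \<in> I \<Longrightarrow> \<sigma>\<^sup>2 \<le> 1 - (w \<bullet> u i)\<^sup>2"
  shows "(\<Sum>i\<in>I. 1 / sqrt (1 - (w \<bullet> u i)\<^sup>2)) \<le> 2 * real (card I) + 64 * (2 / \<sigma> + 3) / \<sigma>"
proof -
  obtain f :: "real^3 \<Rightarrow> real^3" where f: "orthogonal_transformation f" "\<And>x. f x $ 1 = w \<bullet> x"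
    using orthonormal_frame_exists[OF w] by blast
  define I1 where "I1 = {i \<in> I. 1 / 2 \<le> (w \<bullet> u i)\<^sup>2}"
  define v where "v i = (if 0 \<le> w \<bullet> u i then u i else - u i)" for i
  define \<alpha> where "\<alpha> i = \<bar>w \<bullet> u i\<bar>" for i
  define p where "p i = Complex (f (v i) $ 2) (f (v i) $ 3)" for i
  have f1: "f (v i) $ 1 = \<alpha> i" for i by (simp add: f v_def \<alpha>_def)
  have norm3: "(norm x)\<^sup>2 = (x $ 1)\<^sup>2 + (x $ 2)\<^sup>2 + (x $ 3)\<^sup>2" for x :: "real^3"
    unfolding power2_norm_eq_inner inner_vec_def sum_3 by (simp add: power2_eq_square)
  have nv: "norm (v i) = 1" if "i \<in> I" for i using u[OF that] by (simp add: v_def)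
  have np: "(norm (p i))\<^sup>2 = 1 - (\<alpha> i)\<^sup>2" if "i \<in> I" for i
  proof -
    have "1 = (norm (f (v i)))\<^sup>2" using f(1) nv[OF that] by (simp add: orthogonal_transformation_norm)
    then show ?thesis unfolding norm3 f1 by (simp add: p_def cmod_power2)
  qed
  have np_sqrt: "norm (p i) = sqrt (1 - (w \<bullet> u i)\<^sup>2)" if "i \<in> I" for i
    using np[OF that] by (simp add: \<alpha>_def real_sqrt_unique)
  have nsep: "(norm (v i - v j))\<^sup>2 = (\<alpha> i - \<alpha> j)\<^sup>2 + (norm (p i - p j))\<^sup>2" for i j
  proof -
    have "(norm (v i - v j))\<^sup>2 = (norm (f (v i) - f (v j)))\<^sup>2"
      using f(1) by (metis linear_diff orthogonal_transformation_linear orthogonal_transformation_norm)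
    then show ?thesis unfolding norm3 by (simp add: f1 p_def cmod_power2)
  qed
  \<comment> \<open>Grid side \<open>\<sigma> / 2\<close>: the planar lemma then asks for distance
    \<open>\<sigma>\<close> from the origin and squared mutual distance at least half the square of
    \<open>\<sigma>\<close>, the factor 1/2 being the loss in the projection.\<close>
  have "(\<Sum>i\<in>I1. 1 / norm (p i)) \<le> 32 * (1 / (\<sigma> / 2) + 3) / (\<sigma> / 2)"
  proof (rule sum_inverse_norm_separated_le)
    show "finite I1" using I by (simp add: I1_def)
    show "0 < \<sigma> / 2" using \<sigma> by simp
  next
    fix i assume "i \<in> I1"
    then have i: "i \<in> I" by (simp add: I1_def)
    have "\<sigma>\<^sup>2 \<le> (norm (p i))\<^sup>2" using sep_w[OF i] np[OF i] by (simp add: \<alpha>_def)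
    then have "\<sigma> \<le> norm (p i)" by (rule power2_le_imp_le) simp
    then show "2 * (\<sigma> / 2) \<le> norm (p i)" by simp
    have "(norm (p i))\<^sup>2 \<le> 1\<^sup>2" using np[OF i] by simp
    then show "norm (p i) \<le> 1" by (rule power2_le_imp_le) simp
  next
    fix i j assume ij1: "i \<in> I1" "j \<in> I1" "i \<noteq> j"
    then have ij: "i \<in> I" "j \<in> I" by (auto simp: I1_def)
    have p_le: "norm (p k) \<le> \<alpha> k" and \<alpha>_pos: "0 < \<alpha> k" if "k \<in> I1" for k
    proof -
      have k: "1 / 2 \<le> (\<alpha> k)\<^sup>2" "k \<in> I" using that by (auto simp: I1_def \<alpha>_def)
      then have "(norm (p k))\<^sup>2 \<le> (\<alpha> k)\<^sup>2" using np[of k] by simp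
      then show "norm (p k) \<le> \<alpha> k" by (rule power2_le_imp_le) (simp add: \<alpha>_def)
      have "\<alpha> k \<noteq> 0" using k by auto
      then show "0 < \<alpha> k" by (simp add: \<alpha>_def)
    qed
    define d where "d = norm (p i - p j)"
    have \<alpha>_sum_pos: "0 < \<alpha> i + \<alpha> j" using \<alpha>_pos ij1 by (intro add_pos_pos)
    \<comment> \<open>Height and projection satisfy \<alpha>^2 + |p|^2 = 1, and |p| is at most
      \<alpha> on \<open>I1\<close>. Comparing the differences of squares shows that the heights
      differ by no more than the projections do.\<close>
    have "\<bar>\<alpha> i - \<alpha> j\<bar> * (\<alpha> i + \<alpha> j) = \<bar>(\<alpha> i - \<alpha> j) * (\<alpha> i + \<alpha> j)\<bar>"
      using \<alpha>_sum_pos by (simp add: abs_mult)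
    also have "(\<alpha> i - \<alpha> j) * (\<alpha> i + \<alpha> j) = - ((norm (p i) - norm (p j)) * (norm (p i) + norm (p j)))"
      using np[OF ij(1)] np[OF ij(2)] by (simp add: power2_eq_square algebra_simps)
    also have "\<bar>\<dots>\<bar> = \<bar>norm (p i) - norm (p j)\<bar> * (norm (p i) + norm (p j))"
      by (simp add: abs_mult)
    also have "\<dots> \<le> d * (\<alpha> i + \<alpha> j)"
      using p_le ij1 norm_triangle_ineq3[of "p i" "p j"] by (intro mult_mono add_mono) (auto simp: d_def)
    finally have "\<bar>\<alpha> i - \<alpha> j\<bar> \<le> d" using \<alpha>_sum_pos by simp
    then have "(\<alpha> i - \<alpha> j)\<^sup>2 \<le> d\<^sup>2" by (simp add: d_def abs_le_square_iff[symmetric])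
    then have "(norm (v i - v j))\<^sup>2 \<le> 2 * d\<^sup>2" unfolding nsep d_def by simp
    moreover have "(norm (v i - v j))\<^sup>2 = 2 - 2 * (v i \<bullet> v j)"
      using nv[OF ij(1)] nv[OF ij(2)]
      by (simp add: power2_norm_eq_inner norm_eq_1 inner_commute algebra_simps)
    moreover have "v i \<bullet> v j \<le> \<bar>u i \<bullet> u j\<bar>" by (auto simp: v_def)
    \<comment> \<open>This turns separation of lines, measured by the squared sine, into a lower
      bound for the chord between the oriented unit vectors.\<close>
    moreover have "1 - (u i \<bullet> u j)\<^sup>2 \<le> 2 - 2 * \<bar>u i \<bullet> u j\<bar>"
    proof -
      have "0 \<le> (1 - \<bar>u i \<bullet> u j\<bar>)\<^sup>2" by simp
      then show ?thesis by (simp add: power2_eq_square algebra_simps)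
    qed
    moreover have "\<sigma>\<^sup>2 \<le> 1 - (u i \<bullet> u j)\<^sup>2" using sep ij ij1 by blast
    ultimately have "\<sigma>\<^sup>2 \<le> 2 * d\<^sup>2" by linarith
    then show "2 * (\<sigma> / 2)\<^sup>2 \<le> (norm (p i - p j))\<^sup>2" by (simp add: d_def power_divide)
  qed
  then have sum1: "(\<Sum>i\<in>I1. 1 / sqrt (1 - (w \<bullet> u i)\<^sup>2)) \<le> 64 * (2 / \<sigma> + 3) / \<sigma>"
    by (simp add: np_sqrt I1_def)
  have "(\<Sum>i\<in>I - I1. 1 / sqrt (1 - (w \<bullet> u i)\<^sup>2)) \<le> (\<Sum>i\<in>I - I1. 2)"
  proof (rule sum_mono)
    fix i assume "i \<in> I - I1"
    \<comment> \<open>Off \<open>I1\<close> the squared sine exceeds 1/2; the cruder bound 1/4 has a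
      rational root and gives 2 per term.\<close>
    then have "(1 / 2)\<^sup>2 \<le> 1 - (w \<bullet> u i)\<^sup>2" by (auto simp: I1_def power2_eq_square)
    then have "1 / 2 \<le> sqrt (1 - (w \<bullet> u i)\<^sup>2)" by (rule real_le_rsqrt)
    then show "1 / sqrt (1 - (w \<bullet> u i)\<^sup>2) \<le> 2" by (subst pos_divide_le_eq; linarith)
  qed
  also have "\<dots> \<le> 2 * real (card I)" using I by (simp add: card_mono)
  finally have sum2: "(\<Sum>i\<in>I - I1. 1 / sqrt (1 - (w \<bullet> u i)\<^sup>2)) \<le> 2 * real (card I)" .
  have "(\<Sum>i\<in>I. 1 / sqrt (1 - (w \<bullet> u i)\<^sup>2))
    = (\<Sum>i\<in>I - I1. 1 / sqrt (1 - (w \<bullet> u i)\<^sup>2)) + (\<Sum>i\<in>I1. 1 / sqrt (1 - (w \<bullet> u i)\<^sup>2))"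
    using I by (intro sum.subset_diff) (auto simp: I1_def)
  then show ?thesis using sum1 sum2 by linarith
qed

section \<open>The union of the bands\<close>

text \<open>Monotonicity of \<open>arccos\<close> gives
  \<open>\<bar>u \<bullet> v\<bar> \<le> cos t\<close>, so the right-hand side is at least the
  square of \<open>sin t\<close>, which \<open>half_le_sin\<close> bounds below. It makes the angle
  hypothesis algebraic in the normals.\<close>

lemma sq_half_angle_le_sin_sq:
  assumes t: "0 \<le> t" "t \<le> 1" and u: "norm u = 1" "norm v = 1"
    and angle: "t \<le> arccos \<bar>u \<bullet> v\<bar>"
  shows "(t / 2)\<^sup>2 \<le> 1 - (u \<bullet> v)\<^sup>2"
proof -
  have c1: "\<bar>u \<bullet> v\<bar> \<le> 1" using Cauchy_Schwarz_ineq2[of u v] u by simp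
  have "t \<le> pi" using t pi_gt3 by linarith
  then have "arccos (cos t) \<le> arccos \<bar>u \<bullet> v\<bar>" using t angle by (simp add: arccos_cos)
  then have "\<bar>u \<bullet> v\<bar> \<le> cos t" using c1 by (subst (asm) arccos_le_mono) auto
  then have "\<bar>u \<bullet> v\<bar>\<^sup>2 \<le> (cos t)\<^sup>2" by (intro power_mono) auto
  moreover have "(t / 2)\<^sup>2 \<le> (sin t)\<^sup>2" using half_le_sin[OF t] t by (intro power_mono) auto
  ultimately show ?thesis by (simp add: cos_squared_eq)
qed

text \<open>With thickness proportional to \<open>1 / real n\<close>, the sum of the volumes is
  bounded below and the sum of all pairwise overlaps is bounded above, both independently of
  \<open>n\<close>; each row of overlaps is of order \<open>1 / real n\<close>.\<close>

lemma measure_UN_band_ge: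
  fixes u :: "'i \<Rightarrow> real^3"
  assumes I: "finite I" "I \<noteq> {}" and n: "n = card I"
    and u: "\<And>i. i \<in> I \<Longrightarrow> norm (u i) = 1"
    and sep: "\<And>i j. i \<in> I \<Longrightarrow> j \<in> I \<Longrightarrow> i \<noteq> j \<Longrightarrow>
      (1 / (200 * sqrt (real n)))\<^sup>2 \<le> 1 - (u i \<bullet> u j)\<^sup>2"
  shows "1 / 10 ^ 10 \<le> measure lebesgue (\<Union>i\<in>I. band (1 / (4 * real n)) (u i))"
proof -
  define \<delta> where "\<delta> = 1 / (4 * real n)"
  define \<sigma> where "\<sigma> = 1 / (200 * sqrt (real n))"
  define m where "m i j = measure lebesgue (band \<delta> (u i) \<inter> band \<delta> (u j))" for i j
  have n1: "1 \<le> real n" using I n by (simp add: Suc_le_eq card_gt_0_iff)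
  have \<delta>: "0 < \<delta>" "\<delta> \<le> 1 / 4" "real n * \<delta> = 1 / 4" using n1 by (auto simp: \<delta>_def field_simps)
  have \<sigma>: "0 < \<sigma>" using n1 by (simp add: \<sigma>_def)
  have diag: "m i i \<le> 2 / real n" if "i \<in> I" for i
    using measure_band_le[OF u[OF that], of \<delta>] \<delta>(1) by (simp add: m_def \<delta>_def)
  have off: "m i j \<le> 1 / (real n)\<^sup>2 * (1 / sqrt (1 - (u i \<bullet> u j)\<^sup>2))"
    if "i \<in> I" "j \<in> I" "i \<noteq> j" for i j
  proof -
    have "0 < \<sigma>\<^sup>2" using \<sigma> by simp
    also have "\<sigma>\<^sup>2 \<le> 1 - (u i \<bullet> u j)\<^sup>2" unfolding \<sigma>_def using sep[OF that] .
    finally have "m i j \<le> 16 * \<delta>\<^sup>2 / sqrt (1 - (u i \<bullet> u j)\<^sup>2)"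
      unfolding m_def using \<delta>(1) that u by (intro measure_band_Int_le) auto
    also have "16 * \<delta>\<^sup>2 = 1 / (real n)\<^sup>2" by (simp add: \<delta>_def power_divide power_mult_distrib)
    finally show ?thesis by simp
  qed
  have row: "(\<Sum>j\<in>I. m i j) \<le> 6000000 / real n" if i: "i \<in> I" for i
  proof -
    have "(\<Sum>j\<in>I - {i}. 1 / sqrt (1 - (u i \<bullet> u j)\<^sup>2))
        \<le> 2 * real (card (I - {i})) + 64 * (2 / \<sigma> + 3) / \<sigma>"
      using I \<sigma> u i sep by (intro sum_inverse_sin_separated_le) (auto simp: \<sigma>_def)
    also have "\<dots> \<le> 2 * real n + 64 * (2 / \<sigma> + 3) / \<sigma>"
      using I n by (simp add: card_mono)
    \<comment> \<open>Here \<open>1 / \<sigma> = 200 * sqrt (real n)\<close>. As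
      \<open>sqrt (real n) \<le> real n\<close>, the coefficients add up to 2 + 5120000 + 38400 <
      5900000.\<close>
    also have "64 * (2 / \<sigma> + 3) / \<sigma> = 5120000 * (sqrt (real n))\<^sup>2 + 38400 * sqrt (real n)"
      using n1 by (simp add: \<sigma>_def power2_eq_square algebra_simps)
    also have "2 * real n + \<dots> \<le> 5900000 * real n"
    proof -
      have "sqrt (real n) \<le> real n" using n1 by (intro real_le_lsqrt) (auto simp: power2_eq_square)
      then show ?thesis using n1 by simp
    qed
    finally have sum: "(\<Sum>j\<in>I - {i}. 1 / sqrt (1 - (u i \<bullet> u j)\<^sup>2)) \<le> 5900000 * real n" by simp
    have "(\<Sum>j\<in>I. m i j) = m i i + (\<Sum>j\<in>I - {i}. m i j)"
      using I i by (simp add: sum.remove)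
    also have "(\<Sum>j\<in>I - {i}. m i j) \<le> (\<Sum>j\<in>I - {i}. 1 / (real n)\<^sup>2 * (1 / sqrt (1 - (u i \<bullet> u j)\<^sup>2)))"
      using off i by (intro sum_mono) auto
    also have "\<dots> = 1 / (real n)\<^sup>2 * (\<Sum>j\<in>I - {i}. 1 / sqrt (1 - (u i \<bullet> u j)\<^sup>2))"
      by (simp only: sum_distrib_left)
    also have "\<dots> \<le> 1 / (real n)\<^sup>2 * (5900000 * real n)"
      using sum by (intro mult_left_mono) auto
    also have "\<dots> = 5900000 / real n" by (simp add: power2_eq_square)
    finally have "(\<Sum>j\<in>I. m i j) \<le> 2 / real n + 5900000 / real n" using diag[OF i] by linarith
    also have "\<dots> \<le> 6000000 / real n" using n1 by (simp add: divide_simps)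
    finally show ?thesis .
  qed
  have "(\<Sum>i\<in>I. \<Sum>j\<in>I. m i j) \<le> (\<Sum>i\<in>I. 6000000 / real n)"
    by (intro sum_mono row)
  also have "\<dots> = 6000000" using n n1 by simp
  finally have second: "(\<Sum>i\<in>I. \<Sum>j\<in>I. m i j) \<le> 6000000" .
  have "1 / 32 = (\<Sum>i\<in>I. \<delta> / 8)" using n \<delta>(3) by simp
  also have "\<dots> \<le> (\<Sum>i\<in>I. measure lebesgue (band \<delta> (u i)))"
    using \<delta> u by (intro sum_mono measure_band_ge) auto
  finally have first: "1 / 32 \<le> (\<Sum>i\<in>I. measure lebesgue (band \<delta> (u i)))" .
  \<comment> \<open>about the optimal \<open>\<lambda> = (1 / 32) / 6000000\<close>\<close>
  define l :: real where "l = 1 / 200000000"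
  \<comment> \<open>The right-hand side equals 1.625 / 10^10.\<close>
  have "1 / 10 ^ 10 \<le> 2 * l * (1 / 32) - l\<^sup>2 * 6000000" by (simp add: l_def power2_eq_square)
  also have "\<dots> \<le> 2 * l * (\<Sum>i\<in>I. measure lebesgue (band \<delta> (u i))) - l\<^sup>2 * (\<Sum>i\<in>I. \<Sum>j\<in>I. m i j)"
    using first second by (intro diff_mono mult_left_mono) (auto simp: l_def)
  also have "\<dots> \<le> measure lebesgue (\<Union>i\<in>I. band \<delta> (u i))"
    unfolding m_def by (rule measure_UN_ge_second_moment[OF I(1) lmeasurable_band])
  finally show ?thesis by (simp add: \<delta>_def)
qed

theorem mainTheorem4:
  shows "\<exists>c::real. c > 0 \<and>
    (\<forall>n::nat. n \<ge> 1 \<longrightarrow>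
      (\<forall>G :: nat \<Rightarrow> (real^3) set.
        (\<forall>i\<in>{1..n}. great_circle (G i)) \<and>
        (\<forall>i\<in>{1..n}. \<forall>j\<in>{1..n}. i \<noteq> j \<longrightarrow>
            intersection_angle (G i) (G j) \<ge> 1 / (100 * sqrt (real n))) \<longrightarrow>
        surface_area (\<Union>i\<in>{1..n}. geodesic_nbhd (1 / real n) (G i)) \<ge> c))"
proof (intro exI[of _ "3 / 10 ^ 10"] conjI allI impI)
  fix n :: nat and G :: "nat \<Rightarrow> (real^3) set"
  assume n: "1 \<le> n"
  assume G: "(\<forall>i\<in>{1..n}. great_circle (G i)) \<and>
    (\<forall>i\<in>{1..n}. \<forall>j\<in>{1..n}. i \<noteq> j \<longrightarrow>
      intersection_angle (G i) (G j) \<ge> 1 / (100 * sqrt (real n)))"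
  have n1: "1 \<le> real n" using n by simp
  have "\<forall>i\<in>{1..n}. \<exists>P u. plane_through_origin P \<and> G i = S2 \<inter> P \<and> unit_normal P u"
    using G unit_normal_exists unfolding great_circle_def by blast
  then obtain P u where Pu: "\<And>i. i \<in> {1..n} \<Longrightarrow>
      plane_through_origin (P i) \<and> G i = S2 \<inter> P i \<and> unit_normal (P i) (u i)"
    by metis
  have nu: "norm (u i) = 1" if "i \<in> {1..n}" for i
    using Pu[OF that] by (simp add: unit_normal_def)
  \<comment> \<open>Halving this angle in \<open>sq_half_angle_le_sin_sq\<close> produces the 200 in
    the separation of the normals.\<close>
  define t where "t = 1 / (100 * sqrt (real n))"
  have t: "0 \<le> t" "t \<le> 1" using n1 by (auto simp: t_def divide_simps intro: order_trans[of 1 "sqrt (real n)"])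
  have sep: "(1 / (200 * sqrt (real n)))\<^sup>2 \<le> 1 - (u i \<bullet> u j)\<^sup>2"
    if ij: "i \<in> {1..n}" "j \<in> {1..n}" "i \<noteq> j" for i j
  proof -
    have "intersection_angle (G i) (G j) = arccos \<bar>u i \<bullet> u j\<bar>"
      using Pu ij by (simp add: intersection_angle_def span_great_circle plane_angle_eq)
    then have "t \<le> arccos \<bar>u i \<bullet> u j\<bar>" using G ij by (metis t_def)
    from sq_half_angle_le_sin_sq[OF t nu[OF ij(1)] nu[OF ij(2)] this]
    show ?thesis by (simp add: t_def mult.commute)
  qed
  have r: "0 \<le> 1 / real n" "1 / real n \<le> 1" using n1 by auto
  have "geodesic_nbhd (1 / real n) (G i) = {x \<in> S2. \<bar>u i \<bullet> x\<bar> \<le> sin (1 / real n)}"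
    if "i \<in> {1..n}" for i
    using Pu[OF that] r pi_gt3 geodesic_nbhd_great_circle[of "P i" "u i" "1 / real n"] by auto
  then have nbhds: "(\<Union>i\<in>{1..n}. geodesic_nbhd (1 / real n) (G i))
      = (\<Union>i\<in>{1..n}. {x \<in> S2. \<bar>u i \<bullet> x\<bar> \<le> sin (1 / real n)})"
    by auto
  have "3 / 10 ^ 10 \<le> 3 * measure lebesgue (\<Union>i\<in>{1..n}. band (1 / (4 * real n)) (u i))"
    using measure_UN_band_ge[of "{1..n}" n u] n nu sep by simp
  \<comment> \<open>The thickness \<open>1 / (4 * real n)\<close> is chosen so that its double,
    \<open>1 / (2 * real n)\<close>, is at most \<open>sin (1 / real n)\<close>. The factor 3 is the
    one relating area to cone volume.\<close>
  also have "\<dots> \<le> surface_area (\<Union>i\<in>{1..n}. {x \<in> S2. \<bar>u i \<bullet> x\<bar> \<le> sin (1 / real n)})"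
    using half_le_sin[OF r] by (intro surface_area_circle_nbhds_ge) auto
  finally show "3 / 10 ^ 10 \<le> surface_area (\<Union>i\<in>{1..n}. geodesic_nbhd (1 / real n) (G i))"
    unfolding nbhds .
qed simp

end
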